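(* Let $A_1\in\mathbb{R}^{n\times n}$ be an $H_+$-matrix, $q\in\mathbb{R}^n$, $r>0$, and let $\Omega_1\in\mathbb{R}^{n\times n}$ be a positive diagonal matrix. Let $A_1=M_1-N_1=(M_1+I-L_1)-(N_1+I-L_1)$, with $M_1,N_1\in\mathbb{R}^{n\times n}$, be such that the splitting of $A_1$ into $M_1+I-L_1$ and $N_1+I-L_1$ is $H$-compatible, i.e. $$\langle A_1\rangle=\langle M_1+I-L_1\rangle-|N_1+I-L_1| ,$$ and suppose $M_1+\Omega_1+I-L_1$ is nonsingular. Suppose that one of the following conditions holds: (1) $\Omega_1\ge D_1$; (2) $\Omega_1<D_1$ (each diagonal entry of $\Omega_1$ is less than the corresponding diagonal entry of $D_1$) and $2\Omega_1-D_1-|B|$ is an $M$-matrix, where $B=L_1+U_1$. Let $s^*\in\mathbb{R}^n$ be the solution of $$s=(M_1+\Omega_1+I-L_1)^{-1}\big[(N_1+I-L_1)s+(\Omega_1-A_1)|s|-rq\big].$$ Then for any initial vector $s^{(0)}\in\mathbb{R}^n$, the sequence $\{s^{(k)}\}_{k=1}^{+\infty}$ defined by $$s^{(k+1)}=(M_1+\Omega_1+I-L_1)^{-1}\big[(N_1+I-L_1)s^{(k)}+(\Omega_1-A_1)|s^{(k)}|-rq\big],\qquad k=0,1,2,\ldots$$ converges to $s^*$.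
   Context: For a matrix or vector $X$, $|X|$ denotes the entrywise absolute value; matrix inequalities are entrywise. $I$ is the identity matrix of order $n$. Write $A_1=D_1-L_1-U_1$ with $D_1$ the diagonal part of $A_1$, $L_1$ strictly lower triangular and $U_1$ strictly upper triangular. A positive diagonal matrix is a diagonal matrix with positive diagonal entries. The comparison matrix $\langle X\rangle$ of a square matrix $X=(x_{ij})$ has entries $|x_{ii}|$ on the diagonal and $-|x_{ij}|$ for $i\ne j$. A $Z$-matrix is a real square matrix whose off-diagonal entries are all $\le 0$; an $M$-matrix is a nonsingular $Z$-matrix $X$ with $X^{-1}\ge 0$; an $H$-matrix is a matrix $X$ such that $\langle X\rangle$ is an $M$-matrix; an $H_+$-matrix is an $H$-matrix with all diagonal entries positive. A splitting $X=F-G$ is $H$-compatible if $\langle X\rangle=\langle F\rangle-|G|$. *)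

theory Defs
  imports "HOL-Analysis.Analysis"
begin

text \<open>
  A square matrix of order \<open>n\<close> is an element of \<open>real^'n^'n\<close> with \<open>n = CARD('n)\<close>; the linear
  order on \<open>'n\<close>, needed for the triangular parts, enumerates the row and column indices.
  On these types the library's \<open>\<bar>_\<bar>\<close> and \<open>\<le>\<close> act entrywise (see the two lemmas below).
  The library's \<open><\<close> is not the entrywise strict order (it is \<open>\<le>\<close> and \<open>\<noteq>\<close>), and its \<open>1\<close>
  and \<open>*\<close> are entrywise as well: the identity is \<open>mat 1\<close>.
\<close>

lemma abs_matrix_nth: "\<bar>X\<bar> $ i $ j = \<bar>X $ i $ j\<bar>"
  for X :: "real^'n^'m"
  by (simp add: abs_vec_def)

lemma matrix_le_iff: "X \<le> Y \<longleftrightarrow> (\<forall>i j. X $ i $ j \<le> Y $ i $ j)"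
  for X Y :: "real^'n^'m"
  by (simp add: less_eq_vec_def)

text \<open>
  The parts of the splitting \<open>A = D - L - U\<close>; note the signs in \<open>L\<close> and \<open>U\<close>.
\<close>

definition diag_part :: "real^'n^'n \<Rightarrow> real^'n^'n" where
  "diag_part A = (\<chi> i j. if i = j then A $ i $ j else 0)"

definition lower_part :: "real^'n::{finite,linorder}^'n::{finite,linorder} \<Rightarrow>
    real^'n::{finite,linorder}^'n::{finite,linorder}" where
  "lower_part A = (\<chi> i j. if j < i then - A $ i $ j else 0)"

definition upper_part :: "real^'n::{finite,linorder}^'n::{finite,linorder} \<Rightarrow>
    real^'n::{finite,linorder}^'n::{finite,linorder}" where
  "upper_part A = (\<chi> i j. if i < j then - A $ i $ j else 0)"

lemma diag_lower_upper: "A = diag_part A - lower_part A - upper_part A"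
  by (auto simp: vec_eq_iff diag_part_def lower_part_def upper_part_def)

definition positive_diagonal_matrix :: "real^'n^'n \<Rightarrow> bool" where
  "positive_diagonal_matrix X \<longleftrightarrow>
     (\<forall>i j. i \<noteq> j \<longrightarrow> X $ i $ j = 0) \<and> (\<forall>i. X $ i $ i > 0)"

definition comparison_matrix :: "real^'n^'n \<Rightarrow> real^'n^'n" where
  "comparison_matrix X = (\<chi> i j. if i = j then \<bar>X $ i $ j\<bar> else - \<bar>X $ i $ j\<bar>)"

definition Z_matrix :: "real^'n^'n \<Rightarrow> bool" where
  "Z_matrix X \<longleftrightarrow> (\<forall>i j. i \<noteq> j \<longrightarrow> X $ i $ j \<le> 0)"

definition M_matrix :: "real^'n^'n \<Rightarrow> bool" where
  "M_matrix X \<longleftrightarrow> Z_matrix X \<and> invertible X \<and> 0 \<le> matrix_inv X"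

definition H_matrix :: "real^'n^'n \<Rightarrow> bool" where
  "H_matrix X \<longleftrightarrow> M_matrix (comparison_matrix X)"

definition H_plus_matrix :: "real^'n^'n \<Rightarrow> bool" where
  "H_plus_matrix X \<longleftrightarrow> H_matrix X \<and> (\<forall>i. X $ i $ i > 0)"

definition H_compatible_splitting :: "real^'n^'n \<Rightarrow> real^'n^'n \<Rightarrow> real^'n^'n \<Rightarrow> bool" where
  "H_compatible_splitting X F G \<longleftrightarrow>
     X = F - G \<and> comparison_matrix X = comparison_matrix F - \<bar>G\<bar>"

end

theory Submission
  imports Defs
begin

text \<open>
  Put \<open>F = M1 + I - L1\<close> and \<open>G = N1 + I - L1\<close>, so that \<open>A1 = F - G\<close>. Subtracting the fixed-point
  equation from the iteration shows that the errors \<open>e k = s k - s_star\<close> satisfy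
  \<open>(F + \<Omega>1) e (k+1) = G e k + (\<Omega>1 - A1) (\<bar>s k\<bar> - \<bar>s_star\<bar>)\<close>, and \<open>\<bar>\<bar>s k\<bar> - \<bar>s_star\<bar>\<bar> \<le> \<bar>e k\<bar>\<close>.
  Moving the off-diagonal part of \<open>F + \<Omega>1\<close> to the right-hand side and taking absolute values
  (\<open>comparison_matrix_mult_abs_le\<close>) gives \<open>P \<bar>e (k+1)\<bar> \<le> T \<bar>e k\<bar>\<close> with the Z-matrix
  \<open>P = \<langle>F + \<Omega>1\<rangle>\<close> and the nonnegative matrix \<open>T = \<bar>G\<bar> + \<bar>\<Omega>1 - A1\<bar>\<close>.

  Such a recursion is a contraction in a weighted maximum norm as soon as some entrywise positive
  vector \<open>v\<close> has \<open>P v > T v\<close> (\<open>Z_matrix_iteration_tendsto_0\<close>). This replaces a spectral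
  radius estimate for \<open>P\<^sup>-\<^sup>1 T\<close>, and the only tool behind it is a maximum principle
  (\<open>Z_matrix_maximum_principle\<close>).

  To find \<open>v\<close>, write \<open>D1\<close> for the diagonal part of \<open>A1\<close>. H-compatibility forces the diagonal
  entries of \<open>F\<close> to be positive, hence \<open>\<langle>F + \<Omega>1\<rangle> = \<langle>F\<rangle> + \<Omega>1\<close> and
  \<open>P - T = \<langle>A1\<rangle> + \<Omega>1 - \<bar>\<Omega>1 - A1\<bar>\<close>, where \<open>\<langle>A1\<rangle> = D1 - \<bar>B\<bar>\<close>.
  If \<open>\<Omega>1 \<ge> D1\<close>, this is \<open>2 \<langle>A1\<rangle>\<close>. If \<open>\<Omega>1 < D1\<close>, it is the sum of \<open>Q = 2 \<Omega>1 - D1 - \<bar>B\<bar>\<close> and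
  \<open>\<langle>A1\<rangle>\<close>, and \<open>\<langle>A1\<rangle> \<ge> Q\<close>. So it suffices that \<open>v > 0\<close> and that \<open>\<langle>A1\<rangle> v > 0\<close> in the first case,
  \<open>Q v > 0\<close> in the second; M-matrices admit such a vector (\<open>M_matrix_positive_vector\<close>).
\<close>

section \<open>Positive vectors for M-matrices\<close>

lemma matrix_mul_matrix_inv: "X ** matrix_inv X = mat 1"
  and matrix_inv_mul_matrix: "matrix_inv X ** X = mat 1"
  if "invertible X"
  using someI_ex[of "\<lambda>Y. X ** Y = mat 1 \<and> Y ** X = mat 1"] that
  by (auto simp: invertible_def matrix_inv_def)

text \<open>
  The vector is \<open>X\<^sup>-\<^sup>1\<close> applied to the all-ones vector. Its entries are the row sums of the
  nonnegative matrix \<open>X\<^sup>-\<^sup>1\<close>, and no row of an invertible matrix vanishes.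
\<close>

lemma M_matrix_positive_vector:
  fixes X :: "real^'n^'n"
  assumes "M_matrix X"
  obtains v where "\<And>i. v $ i > 0" and "\<And>i. (X *v v) $ i > 0"
proof -
  let ?Y = "matrix_inv X"
  define v where "v = ?Y *v 1"
  have inv: "invertible X" and nonneg: "\<And>i j. ?Y $ i $ j \<ge> 0"
    using assms by (auto simp: M_matrix_def less_eq_vec_def)
  have "X *v v = 1"
    using inv by (simp add: v_def matrix_vector_mul_assoc matrix_mul_matrix_inv)
  then have Xv_pos: "(X *v v) $ i > 0" for i
    by simp
  have v: "v $ i = (\<Sum>j\<in>UNIV. ?Y $ i $ j)" for i
    by (simp add: v_def matrix_vector_mult_def)
  have v_pos: "v $ i > 0" for i
  proof (rule ccontr)
    assume "\<not> v $ i > 0"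
    then have "(\<Sum>j\<in>UNIV. ?Y $ i $ j) = 0"
      using nonneg v by (metis antisym_conv2 sum_nonneg)
    then have "?Y $ i $ j = 0" for j
      using nonneg by (simp add: sum_nonneg_eq_0_iff)
    then have "(?Y ** X) $ i $ i = 0"
      by (simp add: matrix_matrix_mult_def)
    then show False
      using inv by (simp add: matrix_inv_mul_matrix mat_def)
  qed
  show thesis
    by (rule that[OF v_pos Xv_pos])
qed

section \<open>Contraction for Z-matrices\<close>

text \<open>
  At an index where \<open>y $ i / v $ i\<close> takes its maximum \<open>t\<close>, the off-diagonal signs of \<open>P\<close> give
  \<open>(P y) $ i \<ge> t * (P v) $ i\<close>. A positive \<open>t\<close> would therefore make this entry of \<open>P y\<close> positive.
\<close>

lemma Z_matrix_maximum_principle: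
  fixes P :: "real^'n^'n"
  assumes "Z_matrix P"
    and v: "\<And>i. v $ i > 0"
    and Pv: "\<And>i. (P *v v) $ i > 0"
    and Py: "\<And>i. (P *v y) $ i \<le> 0"
  shows "y $ k \<le> 0"
proof -
  define t where "t = Max (range (\<lambda>i. y $ i / v $ i))"
  have le_t: "y $ i / v $ i \<le> t" for i
    by (simp add: t_def)
  have "t \<in> range (\<lambda>i. y $ i / v $ i)"
    unfolding t_def by (rule Max_in) auto
  then obtain i where i: "t = y $ i / v $ i"
    by blast
  have y_le: "y $ j \<le> t * v $ j" for j
    using le_t[of j] v[of j] by (simp add: pos_divide_le_eq)
  have yi: "y $ i = t * v $ i"
    using i v[of i] by simp
  have "P $ i $ j * (t * v $ j) \<le> P $ i $ j * y $ j" for j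
    using assms(1) y_le[of j] yi
    by (cases "j = i") (auto simp: Z_matrix_def intro: mult_left_mono_neg)
  then have "t * (P *v v) $ i \<le> (P *v y) $ i"
    by (simp add: matrix_vector_mult_def sum_distrib_left mult.left_commute sum_mono)
  then have "t * (P *v v) $ i \<le> 0"
    using Py[of i] by linarith
  then have "t \<le> 0"
    using Pv[of i] by (meson mult_pos_pos not_le)
  then show ?thesis
    using y_le[of k] v[of k] by (meson less_imp_le mult_nonpos_nonneg order_trans)
qed

lemma matrix_vector_mult_mono:
  fixes T :: "real^'n^'m"
  assumes "\<And>i j. T $ i $ j \<ge> 0" and "\<And>j. x $ j \<le> y $ j"
  shows "(T *v x) $ i \<le> (T *v y) $ i"
  by (simp add: matrix_vector_mult_def assms sum_mono mult_left_mono)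

text \<open>
  Since there are finitely many rows, \<open>T v < P v\<close> improves to \<open>T v \<le> \<rho> P v\<close> with one \<open>\<rho> < 1\<close>.
  The maximum principle, applied to \<open>x (k+1) - \<rho> c v\<close>, then turns a bound \<open>x k \<le> c v\<close> into
  \<open>x (k+1) \<le> \<rho> c v\<close>.
\<close>

lemma Z_matrix_iteration_tendsto_0:
  fixes P T :: "real^'n^'n" and x :: "nat \<Rightarrow> real^'n"
  assumes Z: "Z_matrix P"
    and T: "\<And>i j. T $ i $ j \<ge> 0"
    and v: "\<And>i. v $ i > 0"
    and less: "\<And>i. (T *v v) $ i < (P *v v) $ i"
    and x: "\<And>k i. x k $ i \<ge> 0"
    and step: "\<And>k i. (P *v x (Suc k)) $ i \<le> (T *v x k) $ i"
  shows "x \<longlonglongrightarrow> 0"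
proof -
  have Tv: "(T *v v) $ i \<ge> 0" for i
    using matrix_vector_mult_mono[of T 0 v i] T v by (simp add: less_imp_le)
  have Pv: "(P *v v) $ i > 0" for i
    using Tv[of i] less[of i] by linarith
  define \<rho> where "\<rho> = Max (range (\<lambda>i. (T *v v) $ i / (P *v v) $ i))"
  define c where "c = Max (range (\<lambda>i. x 0 $ i / v $ i))"
  have \<rho>_ge: "(T *v v) $ i / (P *v v) $ i \<le> \<rho>" for i
    by (simp add: \<rho>_def)
  have c_ge: "x 0 $ i / v $ i \<le> c" for i
    by (simp add: c_def)
  have "\<rho> < 1"
    using less Pv by (simp add: \<rho>_def)
  have "\<rho> \<ge> 0"
    using \<rho>_ge Tv Pv by (meson divide_nonneg_pos order_trans)
  have "c \<ge> 0"
    using c_ge x v by (meson divide_nonneg_pos order_trans)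
  have Tv_le: "(T *v v) $ i \<le> \<rho> * (P *v v) $ i" for i
    using \<rho>_ge[of i] Pv[of i] by (simp add: pos_divide_le_eq)
  have bound: "x k $ i \<le> c * \<rho> ^ k * v $ i" for k i
  proof (induction k arbitrary: i)
    case 0
    then show ?case
      using c_ge[of i] v[of i] by (simp add: pos_divide_le_eq)
  next
    case (Suc k)
    define y where "y = x (Suc k) - (c * \<rho> ^ Suc k) *\<^sub>R v"
    have "(P *v y) $ j \<le> 0" for j
    proof -
      have "(P *v x (Suc k)) $ j \<le> (T *v ((c * \<rho> ^ k) *\<^sub>R v)) $ j"
        using step[of k j] matrix_vector_mult_mono[of T "x k" "(c * \<rho> ^ k) *\<^sub>R v" j] T Suc
        by (auto intro: order_trans)
      also have "\<dots> = c * \<rho> ^ k * (T *v v) $ j"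
        by (simp add: matrix_vector_mult_scaleR)
      also have "\<dots> \<le> c * \<rho> ^ k * (\<rho> * (P *v v) $ j)"
        using Tv_le \<open>c \<ge> 0\<close> \<open>\<rho> \<ge> 0\<close> by (simp add: mult_left_mono)
      finally show ?thesis
        by (simp add: y_def matrix_vector_mult_diff_distrib matrix_vector_mult_scaleR mult_ac)
    qed
    then have "y $ i \<le> 0"
      by (rule Z_matrix_maximum_principle[OF Z v Pv])
    then show ?case
      by (simp add: y_def)
  qed
  have "(\<lambda>k. x k $ i) \<longlonglongrightarrow> 0" for i
  proof (rule tendsto_sandwich[OF _ _ tendsto_const])
    have "(\<lambda>k. \<rho> ^ k) \<longlonglongrightarrow> 0"
      using \<open>\<rho> \<ge> 0\<close> \<open>\<rho> < 1\<close> by (intro LIMSEQ_power_zero) simp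
    then have "(\<lambda>k. c * \<rho> ^ k * v $ i) \<longlonglongrightarrow> c * 0 * v $ i"
      by (intro tendsto_mult tendsto_const)
    then show "(\<lambda>k. c * \<rho> ^ k * v $ i) \<longlonglongrightarrow> 0"
      by simp
  qed (use x bound in auto)
  then show ?thesis
    by (intro vec_tendstoI) simp
qed

section \<open>Comparison matrices and H-compatible splittings\<close>

lemma Z_matrix_comparison_matrix: "Z_matrix (comparison_matrix X)"
  by (simp add: Z_matrix_def comparison_matrix_def)

lemma abs_matrix_vector_mult_le:
  fixes X :: "real^'n^'m"
  shows "\<bar>(X *v x) $ i\<bar> \<le> (\<bar>X\<bar> *v \<bar>x\<bar>) $ i"
  using sum_abs[of "\<lambda>j. X $ i $ j * x $ j" UNIV]
  by (simp add: matrix_vector_mult_def abs_vec_def abs_mult)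

text \<open>
  In row \<open>i\<close> the diagonal term \<open>X $ i $ i * x $ i\<close> is \<open>(X x) $ i\<close> minus the off-diagonal terms;
  the claim is the triangle inequality for this difference.
\<close>

lemma comparison_matrix_mult_abs_le:
  fixes X :: "real^'n^'n"
  shows "(comparison_matrix X *v \<bar>x\<bar>) $ i \<le> \<bar>(X *v x) $ i\<bar>"
proof -
  let ?R = "\<Sum>j\<in>UNIV - {i}. X $ i $ j * x $ j"
  have "(X *v x) $ i = X $ i $ i * x $ i + ?R"
    by (simp add: matrix_vector_mult_def sum.remove[of UNIV i])
  moreover have "(comparison_matrix X *v \<bar>x\<bar>) $ i =
      \<bar>X $ i $ i * x $ i\<bar> - (\<Sum>j\<in>UNIV - {i}. \<bar>X $ i $ j * x $ j\<bar>)"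
    by (simp add: matrix_vector_mult_def sum.remove[of UNIV i] comparison_matrix_def abs_vec_def
        abs_mult sum_negf)
  moreover have "\<bar>?R\<bar> \<le> (\<Sum>j\<in>UNIV - {i}. \<bar>X $ i $ j * x $ j\<bar>)"
    by (rule sum_abs)
  ultimately show ?thesis
    by linarith
qed

text \<open>
  On the diagonal, H-compatibility reads \<open>\<bar>f - g\<bar> = \<bar>f\<bar> - \<bar>g\<bar>\<close>, so \<open>f\<close> and \<open>g\<close> do not have
  opposite signs and \<open>f\<close> dominates: \<open>f\<close> has the sign of \<open>f - g\<close>.
\<close>

lemma H_compatible_splitting_diagonal_pos:
  assumes "H_compatible_splitting X F G" and "X $ i $ i > 0"
  shows "F $ i $ i > 0"
proof -
  have "X = F - G" and "comparison_matrix X = comparison_matrix F - \<bar>G\<bar>"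
    using assms(1) by (auto simp: H_compatible_splitting_def)
  then have "X $ i $ i = F $ i $ i - G $ i $ i"
    and "comparison_matrix X $ i $ i = (comparison_matrix F - \<bar>G\<bar>) $ i $ i"
    by simp_all
  then have "\<bar>F $ i $ i - G $ i $ i\<bar> = \<bar>F $ i $ i\<bar> - \<bar>G $ i $ i\<bar>"
    by (simp add: comparison_matrix_def abs_vec_def)
  then show ?thesis
    using assms(2) \<open>X $ i $ i = F $ i $ i - G $ i $ i\<close> by linarith
qed

section \<open>Convergence of the iteration\<close>

theorem theorem4p2:
  fixes A1 M1 N1 \<Omega>1 D1 L1 U1 B :: "real^'n::{finite,linorder}^'n::{finite,linorder}"
    and q s_star s0 :: "real^'n::{finite,linorder}"
    and r :: real
    and s :: "nat \<Rightarrow> real^'n::{finite,linorder}"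
  assumes "H_plus_matrix A1"
    and "r > 0"
    and "positive_diagonal_matrix \<Omega>1"
    and "D1 = diag_part A1"
    and "L1 = lower_part A1"
    and "U1 = upper_part A1"
    and "B = L1 + U1"
    and "A1 = M1 - N1"
    and "H_compatible_splitting A1 (M1 + mat 1 - L1) (N1 + mat 1 - L1)"
    and "invertible (M1 + \<Omega>1 + mat 1 - L1)"
    and "\<Omega>1 \<ge> D1 \<or>
         ((\<forall>i. \<Omega>1 $ i $ i < D1 $ i $ i) \<and> M_matrix (2 *\<^sub>R \<Omega>1 - D1 - \<bar>B\<bar>))"
    and "s_star = matrix_inv (M1 + \<Omega>1 + mat 1 - L1) *v
           ((N1 + mat 1 - L1) *v s_star + (\<Omega>1 - A1) *v \<bar>s_star\<bar> - r *\<^sub>R q)"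
    and "s 0 = s0"
    and "\<And>k. s (Suc k) = matrix_inv (M1 + \<Omega>1 + mat 1 - L1) *v
           ((N1 + mat 1 - L1) *v s k + (\<Omega>1 - A1) *v \<bar>s k\<bar> - r *\<^sub>R q)"
  shows "s \<longlonglongrightarrow> s_star"
proof -
  define F where "F = M1 + mat 1 - L1"
  define G where "G = N1 + mat 1 - L1"
  define P where "P = comparison_matrix (F + \<Omega>1)"
  define T where "T = \<bar>G\<bar> + \<bar>\<Omega>1 - A1\<bar>"
  define e where "e k = s k - s_star" for k
  have split: "H_compatible_splitting A1 F G"
    using assms(9) by (simp add: F_def G_def)
  have A_diag: "A1 $ i $ i > 0" and \<Omega>_diag: "\<Omega>1 $ i $ i > 0" for i
    using assms(1,3) by (simp_all add: H_plus_matrix_def positive_diagonal_matrix_def)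
  have \<Omega>_off: "\<Omega>1 $ i $ j = 0" if "i \<noteq> j" for i j
    using assms(3) that by (simp add: positive_diagonal_matrix_def)
  have D: "D1 $ i $ j = (if i = j then A1 $ i $ i else 0)" for i j
    by (simp add: assms(4) diag_part_def)
  have B: "B $ i $ j = (if i = j then 0 else - A1 $ i $ j)" for i j
    by (auto simp: assms(5-7) lower_part_def upper_part_def)

  have F_diag: "F $ i $ i > 0" for i
    by (rule H_compatible_splitting_diagonal_pos[OF split A_diag])
  have "P = comparison_matrix F + \<Omega>1"
    using F_diag \<Omega>_diag \<Omega>_off
    by (auto simp: vec_eq_iff P_def comparison_matrix_def abs_of_pos add_pos_pos)
  then have P_minus_T: "P - T = comparison_matrix A1 + \<Omega>1 - \<bar>\<Omega>1 - A1\<bar>"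
    using split unfolding T_def H_compatible_splitting_def by (metis add_diff_eq diff_add_eq diff_diff_eq)

  obtain v where v: "\<And>i. v $ i > 0" and PTv: "\<And>i. ((P - T) *v v) $ i > 0"
    using assms(11)
  proof
    assume "\<Omega>1 \<ge> D1"
    then have ge: "\<Omega>1 $ i $ i \<ge> A1 $ i $ i" for i
      using D[of i i] by (metis matrix_le_iff)
    have "P - T = 2 *\<^sub>R comparison_matrix A1"
      using ge A_diag \<Omega>_off
      by (simp add: P_minus_T vec_eq_iff comparison_matrix_def abs_vec_def abs_of_pos)
    moreover have "M_matrix (comparison_matrix A1)"
      using assms(1) by (simp add: H_plus_matrix_def H_matrix_def)
    then obtain v where "\<And>i. v $ i > 0" "\<And>i. (comparison_matrix A1 *v v) $ i > 0"
      by (rule M_matrix_positive_vector) blast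
    ultimately show ?thesis
      using that[of v] by (simp add: scaleR_matrix_vector_assoc[symmetric])
  next
    let ?Q = "2 *\<^sub>R \<Omega>1 - D1 - \<bar>B\<bar>"
    assume *: "(\<forall>i. \<Omega>1 $ i $ i < D1 $ i $ i) \<and> M_matrix ?Q"
    then have less: "\<Omega>1 $ i $ i < A1 $ i $ i" for i
      using D[of i i] by metis
    obtain v where v: "\<And>i. v $ i > 0" and Qv: "\<And>i. (?Q *v v) $ i > 0"
      using * M_matrix_positive_vector by blast
    have PT: "P - T = ?Q + comparison_matrix A1"
      using less A_diag \<Omega>_off D B
      by (simp add: P_minus_T vec_eq_iff comparison_matrix_def abs_vec_def abs_of_pos abs_of_neg)
    have "?Q $ i $ j \<le> comparison_matrix A1 $ i $ j" for i j
      using less[of i] A_diag[of i] \<Omega>_off[of i j] D B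
      by (cases "i = j") (auto simp: comparison_matrix_def abs_vec_def)
    then have "(?Q *v v) $ i \<le> (comparison_matrix A1 *v v) $ i" for i
      unfolding matrix_vector_mult_def using v
      by (simp add: sum_mono mult_right_mono less_imp_le)
    then have "((P - T) *v v) $ i > 0" for i
      using Qv[of i] by (smt (verit) PT matrix_vector_mult_add_rdistrib vector_add_component)
    with v show ?thesis
      using that[of v] by blast
  qed

  let ?C = "M1 + \<Omega>1 + mat 1 - L1"
  have C: "?C = F + \<Omega>1"
    by (simp add: F_def)
  have cancel: "?C *v (matrix_inv ?C *v w) = w" for w
    using assms(10) by (simp add: matrix_vector_mul_assoc matrix_mul_matrix_inv)
  have err: "(F + \<Omega>1) *v e (Suc k) = G *v e k + (\<Omega>1 - A1) *v (\<bar>s k\<bar> - \<bar>s_star\<bar>)" for k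
  proof -
    have "?C *v s (Suc k) = G *v s k + (\<Omega>1 - A1) *v \<bar>s k\<bar> - r *\<^sub>R q"
      by (subst assms(14)) (simp add: cancel G_def)
    moreover have "?C *v s_star = G *v s_star + (\<Omega>1 - A1) *v \<bar>s_star\<bar> - r *\<^sub>R q"
      by (subst assms(12)) (simp add: cancel G_def)
    ultimately show ?thesis
      by (simp add: e_def C matrix_vector_mult_diff_distrib)
  qed
  have step: "(P *v \<bar>e (Suc k)\<bar>) $ i \<le> (T *v \<bar>e k\<bar>) $ i" for k i
  proof -
    let ?d = "\<bar>s k\<bar> - \<bar>s_star\<bar>"
    have "(P *v \<bar>e (Suc k)\<bar>) $ i \<le> \<bar>((F + \<Omega>1) *v e (Suc k)) $ i\<bar>"
      unfolding P_def by (rule comparison_matrix_mult_abs_le)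
    also have "\<dots> \<le> \<bar>(G *v e k) $ i\<bar> + \<bar>((\<Omega>1 - A1) *v ?d) $ i\<bar>"
      by (simp add: err abs_triangle_ineq)
    also have "\<dots> \<le> (\<bar>G\<bar> *v \<bar>e k\<bar>) $ i + (\<bar>\<Omega>1 - A1\<bar> *v \<bar>?d\<bar>) $ i"
      by (intro add_mono abs_matrix_vector_mult_le)
    also have "\<dots> \<le> (\<bar>G\<bar> *v \<bar>e k\<bar>) $ i + (\<bar>\<Omega>1 - A1\<bar> *v \<bar>e k\<bar>) $ i"
      by (intro add_left_mono matrix_vector_mult_mono)
        (simp_all add: abs_vec_def e_def abs_triangle_ineq3)
    also have "\<dots> = (T *v \<bar>e k\<bar>) $ i"
      by (simp add: T_def matrix_vector_mult_add_rdistrib)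
    finally show ?thesis .
  qed
  have "(\<lambda>k. \<bar>e k\<bar>) \<longlonglongrightarrow> 0"
  proof (rule Z_matrix_iteration_tendsto_0)
    show "Z_matrix P"
      unfolding P_def by (rule Z_matrix_comparison_matrix)
    show "T $ i $ j \<ge> 0" for i j
      by (simp add: T_def abs_vec_def)
    show "v $ i > 0" for i
      by (rule v)
    show "(T *v v) $ i < (P *v v) $ i" for i
      using PTv[of i] by (simp add: matrix_vector_mult_diff_rdistrib)
    show "\<bar>e k\<bar> $ i \<ge> 0" for k i
      by (simp add: abs_vec_def)
  qed (rule step)
  then have "(\<lambda>k. \<bar>e k\<bar> $ i) \<longlonglongrightarrow> 0 $ i" for i
    by (rule tendsto_vec_nth)
  then have "(\<lambda>k. e k $ i) \<longlonglongrightarrow> 0" for i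
    by (simp add: abs_vec_def tendsto_rabs_zero_iff)
  then have "e \<longlonglongrightarrow> 0"
    by (intro vec_tendstoI) simp
  then show ?thesis
    unfolding e_def by (rule LIM_zero_cancel)
qed

end
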